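(* Suppose $s$, $l$, and $a$ are nonnegative integers such that $l \geq 2$, $a > s+2$, and $(a-s-1)$ does not divide $(l+s+1)$. Let $q=\lfloor(l+s+1)/(a-s-1)\rfloor$ and $$u = \big((1+q)(a-s-1)-(l+s+1)\big)q.$$ If $b$ is an integer with $b \geq a$ and $$b \geq (l+s+1)^s\left(\binom{l+s+1}{l+1} + \binom{l+s+1}{l} (q+1) - \binom{u}{l}\right),$$ then $\tau_s(a,b) \geq l$.
   Context: Convention: $\binom{x}{y}=0$ when $x<y$. All graphs are finite and simple. For graphs $G,H$ on disjoint vertex sets, the join $G \vee H$ is the graph consisting of $G$, $H$, and all edges joining a vertex of $G$ to a vertex of $H$; $K_n$ is the complete graph on $n$ vertices, and $K_0 \vee G$ is understood as $G$. $K_{a,b}$ is the complete bipartite graph with partite sets of sizes $a$ and $b$. $\chi$ denotes chromatic number and $\chi_\ell$ list chromatic number. For a nonnegative integer $s$ and positive integers $a \le b$, $\tau_s(a,b)$ denotes the smallest nonnegative integer $n$ such that $\chi_\ell(K_n \vee K_{a,b}) - \chi(K_n \vee K_{a,b}) \leq s$. *)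

theory Defs
  imports Main
begin

record 'v graph =
  verts :: "'v set"
  adj :: "'v \<Rightarrow> 'v \<Rightarrow> bool"

definition finite_simple_graph :: "'v graph \<Rightarrow> bool" where
  "finite_simple_graph G \<longleftrightarrow>
     finite (verts G) \<and>
     (\<forall>x y. adj G x y \<longrightarrow> x \<in> verts G \<and> y \<in> verts G \<and> x \<noteq> y \<and> adj G y x)"

definition complete_graph :: "nat \<Rightarrow> nat graph" where
  "complete_graph n = \<lparr>verts = {..<n}, adj = (\<lambda>x y. x < n \<and> y < n \<and> x \<noteq> y)\<rparr>"

definition complete_bipartite_graph :: "nat \<Rightarrow> nat \<Rightarrow> (nat + nat) graph" where
  "complete_bipartite_graph a b =
     \<lparr>verts = Inl ` {..<a} \<union> Inr ` {..<b},
      adj = (\<lambda>x y. (x \<in> Inl ` {..<a} \<and> y \<in> Inr ` {..<b}) \<or>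
                   (x \<in> Inr ` {..<b} \<and> y \<in> Inl ` {..<a}))\<rparr>"

(* The sum type makes the two vertex sets disjoint; joining with the empty
   graph gives an isomorphic copy of the other operand. *)
definition graph_join :: "'v graph \<Rightarrow> 'w graph \<Rightarrow> ('v + 'w) graph" where
  "graph_join G H =
     \<lparr>verts = Inl ` verts G \<union> Inr ` verts H,
      adj = (\<lambda>x y. case (x, y) of
               (Inl v, Inl v') \<Rightarrow> adj G v v'
             | (Inr w, Inr w') \<Rightarrow> adj H w w'
             | (Inl v, Inr w) \<Rightarrow> v \<in> verts G \<and> w \<in> verts H
             | (Inr w, Inl v) \<Rightarrow> v \<in> verts G \<and> w \<in> verts H)\<rparr>"

lemma finite_simple_complete_graph: "finite_simple_graph (complete_graph n)"
  by (auto simp: finite_simple_graph_def complete_graph_def)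

lemma finite_simple_complete_bipartite_graph:
  "finite_simple_graph (complete_bipartite_graph a b)"
  by (auto simp: finite_simple_graph_def complete_bipartite_graph_def)

lemma finite_simple_graph_join:
  "finite_simple_graph G \<Longrightarrow> finite_simple_graph H \<Longrightarrow> finite_simple_graph (graph_join G H)"
  by (auto simp: finite_simple_graph_def graph_join_def split: sum.splits)

definition proper_coloring :: "'v graph \<Rightarrow> ('v \<Rightarrow> 'c) \<Rightarrow> bool" where
  "proper_coloring G c \<longleftrightarrow> (\<forall>x\<in>verts G. \<forall>y\<in>verts G. adj G x y \<longrightarrow> c x \<noteq> c y)"

definition colorable :: "'v graph \<Rightarrow> nat \<Rightarrow> bool" where
  "colorable G k \<longleftrightarrow> (\<exists>c :: 'v \<Rightarrow> nat. proper_coloring G c \<and> (\<forall>v\<in>verts G. c v < k))"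

definition chromatic_number :: "'v graph \<Rightarrow> nat" where
  "chromatic_number G = (LEAST k. colorable G k)"

(* Lists are finite, so for a finite graph taking colors in nat loses no generality. *)
definition choosable :: "'v graph \<Rightarrow> nat \<Rightarrow> bool" where
  "choosable G k \<longleftrightarrow>
     (\<forall>L :: 'v \<Rightarrow> nat set.
        (\<forall>v\<in>verts G. finite (L v) \<and> card (L v) = k) \<longrightarrow>
        (\<exists>c. proper_coloring G c \<and> (\<forall>v\<in>verts G. c v \<in> L v)))"

definition list_chromatic_number :: "'v graph \<Rightarrow> nat" where
  "list_chromatic_number G = (LEAST k. choosable G k)"

(* Such an n exists for all s and positive a, b: for every graph G, the list chromatic
   number and the chromatic number of the join of K_n and G agree for all large n (Ohba). *)
definition tau :: "nat \<Rightarrow> nat \<Rightarrow> nat \<Rightarrow> nat" where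
  "tau s a b =
     (LEAST n.
        int (list_chromatic_number (graph_join (complete_graph n) (complete_bipartite_graph a b)))
        - int (chromatic_number (graph_join (complete_graph n) (complete_bipartite_graph a b)))
        \<le> int s)"

end

theory Submission
  imports Defs "HOL-Library.FuncSet"
begin

text \<open>Write \<open>k = l + s + 1\<close> and \<open>N = a - s - 1\<close>. A new dominating
  vertex raises the list chromatic number by at most one
  (\<open>choosable_join_complete_Suc\<close>) and the chromatic number of the cone over the
  complete bipartite graph by exactly one (\<open>chromatic_number_cone\<close>), so their
  difference never grows with the clique. Hence it suffices that the cone with clique size
  \<open>l - 1\<close>, whose chromatic number is \<open>l + 1\<close>, is not
  \<open>k\<close>-choosable, provided the \<open>LEAST\<close> in \<open>tau\<close> is attained at
  all; \<open>choosable_large_cone\<close> secures that, and \<open>tau_ge_of_not_choosable\<close>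
  combines both.

  For \<open>not_choosable_cone\<close>, the lists on the clique and the first side are such that
  every proper colouring of these vertices uses all colours of some \<open>k\<close>-set from a
  family \<open>F\<close> with at most \<open>b\<close> members. Each member is also the list of a
  vertex on the second side, and the vertex whose list is used up cannot be coloured. A member of
  \<open>F\<close> takes one colour from each of \<open>s\<close> fresh \<open>k\<close>-sets,
  whence the factor \<open>k ^ s\<close>, and a core of \<open>l + 1\<close> colours:
  \<open>l\<close> colours of \<open>{..<k}\<close> with either another colour of
  \<open>{..<k}\<close> or one of \<open>q + 1\<close> extra colours. Partitioning
  \<open>{..<k}\<close> into \<open>N\<close> balanced parts (\<open>balanced_partition\<close>)
  keeps the extra colours few; the parts of size \<open>q\<close> cover \<open>u\<close> colours and
  never need the last extra colour, which saves \<open>u choose l\<close> cores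
  (\<open>card_core_family\<close>).\<close>

section \<open>Hall's marriage theorem\<close>

text \<open>Induction on \<open>V\<close>, by whether some nonempty proper subset is tight, that is,
  sees exactly as many colours as it has elements.\<close>

lemma hall_marriage:
  fixes L :: "'v \<Rightarrow> 'c set"
  assumes "finite V" and "\<And>v. v \<in> V \<Longrightarrow> finite (L v)"
    and "\<And>S. S \<subseteq> V \<Longrightarrow> card S \<le> card (\<Union>(L ` S))"
  shows "\<exists>f. inj_on f V \<and> (\<forall>v\<in>V. f v \<in> L v)"
  using assms
proof (induction V arbitrary: L rule: finite_psubset_induct)
  case (psubset V)
  note fin = psubset.prems(1) and H = psubset.prems(2)
  have finU: "finite (\<Union>(L ` S))" if "S \<subseteq> V" for S
    using that fin finite_subset[OF that psubset.hyps] by auto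
  show ?case
  proof (cases "\<exists>S. S \<noteq> {} \<and> S \<subset> V \<and> card (\<Union>(L ` S)) = card S")
    case True
    then obtain S where S: "S \<noteq> {}" "S \<subset> V" "card (\<Union>(L ` S)) = card S" by blast
    have finS: "finite S" using S psubset.hyps finite_subset by blast
    have "\<exists>f. inj_on f S \<and> (\<forall>v\<in>S. f v \<in> L v)"
      by (rule psubset.IH) (use S fin H in auto)
    then obtain f where f: "inj_on f S" "\<forall>v\<in>S. f v \<in> L v" by blast
    \<comment> \<open>Hall's condition survives the removal of the colours of the tight set: apply
      it to \<open>S \<union> T\<close> and subtract the equality for \<open>S\<close>.\<close>
    let ?L = "\<lambda>v. L v - \<Union>(L ` S)"
    have "\<exists>g. inj_on g (V - S) \<and> (\<forall>v\<in>V - S. g v \<in> ?L v)"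
    proof (rule psubset.IH)
      show "V - S \<subset> V" using S by blast
      show "finite (?L v)" if "v \<in> V - S" for v using that fin by auto
      fix T assume T: "T \<subseteq> V - S"
      have "S \<inter> T = {}" "finite T"
        using T psubset.hyps finite_subset by blast+
      then have "card S + card T = card (S \<union> T)"
        using finS by (simp add: card_Un_disjoint)
      also have "\<dots> \<le> card (\<Union>(L ` (S \<union> T)))" using T S by (intro H) auto
      also have "\<Union>(L ` (S \<union> T)) = \<Union>(L ` S) \<union> \<Union>(?L ` T)" by auto
      also have "card \<dots> \<le> card (\<Union>(L ` S)) + card (\<Union>(?L ` T))"
        by (rule card_Un_le)
      finally show "card T \<le> card (\<Union>(?L ` T))" using S(3) by simp
    qed
    then obtain g where g: "inj_on g (V - S)" "\<forall>v\<in>V - S. g v \<in> ?L v" by blast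
    define h where "h v = (if v \<in> S then f v else g v)" for v
    have sep: "f x \<noteq> g y" if "x \<in> S" "y \<in> V - S" for x y
    proof
      assume "f x = g y"
      moreover have "f x \<in> \<Union>(L ` S)" using f(2) that(1) by blast
      moreover have "g y \<notin> \<Union>(L ` S)" using g(2) that(2) by blast
      ultimately show False by metis
    qed
    have "inj_on h V"
    proof (rule inj_onI)
      fix x y assume xy: "x \<in> V" "y \<in> V" "h x = h y"
      show "x = y"
        using xy f(1) g(1) sep[of x y] sep[of y x]
        by (cases "x \<in> S"; cases "y \<in> S") (auto simp: h_def inj_on_def)
    qed
    moreover have "\<forall>v\<in>V. h v \<in> L v" using f g by (auto simp: h_def)
    ultimately show ?thesis by blast
  next
    case False
    show ?thesis
    proof (cases "V = {}")
      case True
      then show ?thesis by auto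
    next
      case nonempty: False
      then obtain v where v: "v \<in> V" by blast
      have "card {v} \<le> card (\<Union>(L ` {v}))" using v by (intro H) auto
      then obtain x where x: "x \<in> L v" by fastforce
      \<comment> \<open>Without tight sets, every nonempty proper subset has a spare colour, so
        losing \<open>x\<close> does no harm.\<close>
      let ?L = "\<lambda>v. L v - {x}"
      have "\<exists>g. inj_on g (V - {v}) \<and> (\<forall>w\<in>V - {v}. g w \<in> ?L w)"
      proof (rule psubset.IH)
        show "V - {v} \<subset> V" using v by blast
        show "finite (?L w)" if "w \<in> V - {v}" for w using that fin by auto
        fix T assume T: "T \<subseteq> V - {v}"
        show "card T \<le> card (\<Union>(?L ` T))"
        proof (cases "T = {}")
          case ne: False
          have TV: "T \<subset> V" using T v by blast
          then have "card T \<noteq> card (\<Union>(L ` T))" using False ne by metis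
          moreover have "card T \<le> card (\<Union>(L ` T))" using TV by (intro H) auto
          moreover have "\<Union>(?L ` T) = \<Union>(L ` T) - {x}" by auto
          then have "card (\<Union>(?L ` T)) \<ge> card (\<Union>(L ` T)) - 1"
            by (simp add: card_Diff_singleton_if)
          ultimately show ?thesis by linarith
        qed simp
      qed
      then obtain g where g: "inj_on g (V - {v})" "\<forall>w\<in>V - {v}. g w \<in> ?L w" by blast
      have "inj_on (g(v := x)) V" using g by (auto simp: inj_on_def)
      moreover have "\<forall>w\<in>V. (g(v := x)) w \<in> L w" using g x by auto
      ultimately show ?thesis by blast
    qed
  qed
qed

section \<open>Choosability and the effect of a dominating vertex\<close>

lemma choosableE:
  fixes L :: "'v \<Rightarrow> nat set"
  assumes "choosable G k" and "\<And>v. v \<in> verts G \<Longrightarrow> finite (L v) \<and> card (L v) = k"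
  obtains c where "proper_coloring G c" and "\<And>v. v \<in> verts G \<Longrightarrow> c v \<in> L v"
proof -
  have "\<exists>c. proper_coloring G c \<and> (\<forall>v\<in>verts G. c v \<in> L v)"
    using assms(1)[unfolded choosable_def, rule_format, of L] assms(2) by simp
  then show thesis using that by auto
qed

lemma choosable_mono:
  assumes "choosable G k" and "k \<le> m"
  shows "choosable G m"
  unfolding choosable_def
proof (intro allI impI)
  fix L :: "'a \<Rightarrow> nat set"
  assume L: "\<forall>v\<in>verts G. finite (L v) \<and> card (L v) = m"
  have "\<forall>v\<in>verts G. \<exists>M. M \<subseteq> L v \<and> card M = k \<and> finite M"
    using L assms(2) by (metis obtain_subset_with_card_n)
  then obtain M where M: "\<forall>v\<in>verts G. M v \<subseteq> L v \<and> card (M v) = k \<and> finite (M v)"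
    by metis
  obtain c where "proper_coloring G c" "\<And>v. v \<in> verts G \<Longrightarrow> c v \<in> M v"
    by (rule choosableE[OF assms(1), of M]) (use M in auto)
  then show "\<exists>c. proper_coloring G c \<and> (\<forall>v\<in>verts G. c v \<in> L v)" using M by blast
qed

lemma finite_simple_graph_adj_neq:
  assumes "finite_simple_graph G" and "adj G v w"
  shows "v \<noteq> w"
  using assms(1)[unfolded finite_simple_graph_def, THEN conjunct2, rule_format, OF assms(2)]
  by simp

lemma proper_coloring_of_inj:
  assumes G: "finite_simple_graph G" and f: "inj_on f (verts G)"
  shows "proper_coloring G f"
  unfolding proper_coloring_def
proof (intro ballI impI)
  fix v w assume vw: "v \<in> verts G" "w \<in> verts G" "adj G v w"
  then have "v \<noteq> w" using G finite_simple_graph_adj_neq by metis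
  then show "f v \<noteq> f w" using f vw(1,2) by (simp add: inj_on_eq_iff)
qed

text \<open>Lists this long satisfy Hall's condition, so all vertices can get different colours.
  This makes the \<open>LEAST\<close> in \<open>list_chromatic_number\<close> attained.\<close>

lemma choosable_card_verts:
  assumes "finite_simple_graph G"
  shows "choosable G (card (verts G))"
  unfolding choosable_def
proof (intro allI impI)
  fix L :: "'a \<Rightarrow> nat set"
  assume L: "\<forall>v\<in>verts G. finite (L v) \<and> card (L v) = card (verts G)"
  have fin: "finite (verts G)" using assms unfolding finite_simple_graph_def by blast
  have "\<exists>f. inj_on f (verts G) \<and> (\<forall>v\<in>verts G. f v \<in> L v)"
  proof (rule hall_marriage)
    fix S assume S: "S \<subseteq> verts G"
    show "card S \<le> card (\<Union>(L ` S))"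
    proof (cases "S = {}")
      case False
      then obtain v where v: "v \<in> S" by blast
      have "finite (\<Union>(L ` S))" using S L finite_subset[OF S fin] by auto
      then have "card (L v) \<le> card (\<Union>(L ` S))" using v by (intro card_mono) auto
      moreover have "card S \<le> card (verts G)" using S fin by (intro card_mono)
      ultimately show ?thesis using L S v by auto
    qed simp
  qed (use L fin in auto)
  then show "\<exists>c. proper_coloring G c \<and> (\<forall>v\<in>verts G. c v \<in> L v)"
    using proper_coloring_of_inj[OF assms] by blast
qed

lemma not_choosable_imp_less_list_chromatic_number:
  assumes "finite_simple_graph G" and "\<not> choosable G k"
  shows "k < list_chromatic_number G"
proof (rule ccontr)
  assume "\<not> ?thesis"
  moreover have "choosable G (list_chromatic_number G)"
    unfolding list_chromatic_number_def by (rule LeastI, rule choosable_card_verts, fact)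
  ultimately show False using assms(2) choosable_mono by (metis not_less)
qed

text \<open>Give the new clique vertex any colour of its list and delete that colour elsewhere;
  every other list keeps at least \<open>k\<close> colours.\<close>

lemma choosable_join_complete_Suc:
  assumes "choosable (graph_join (complete_graph n) H) k"
  shows "choosable (graph_join (complete_graph (Suc n)) H) (Suc k)"
  unfolding choosable_def
proof (intro allI impI)
  let ?G = "graph_join (complete_graph n) H"
  let ?G' = "graph_join (complete_graph (Suc n)) H"
  fix L :: "nat + 'a \<Rightarrow> nat set"
  assume L: "\<forall>v\<in>verts ?G'. finite (L v) \<and> card (L v) = Suc k"
  have verts: "verts ?G' = insert (Inl n) (verts ?G)"
    by (auto simp: graph_join_def complete_graph_def less_Suc_eq)
  have "card (L (Inl n)) = Suc k" using L verts by blast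
  then obtain x where x: "x \<in> L (Inl n)" by fastforce
  have "\<forall>v\<in>verts ?G. \<exists>M. M \<subseteq> L v - {x} \<and> card M = k \<and> finite M"
  proof
    fix v assume "v \<in> verts ?G"
    then have "k \<le> card (L v - {x})"
      using L verts by (simp add: card_Diff_singleton_if)
    then show "\<exists>M. M \<subseteq> L v - {x} \<and> card M = k \<and> finite M"
      by (metis obtain_subset_with_card_n)
  qed
  then obtain M where M: "\<forall>v\<in>verts ?G. M v \<subseteq> L v - {x} \<and> card (M v) = k \<and> finite (M v)"
    by metis
  obtain c where c: "proper_coloring ?G c" "\<And>v. v \<in> verts ?G \<Longrightarrow> c v \<in> M v"
    by (rule choosableE[OF assms, of M]) (use M in auto)
  have cx: "c v \<noteq> x" if "v \<in> verts ?G" for v using c(2)[OF that] M that by auto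
  have adj: "adj ?G' v w \<Longrightarrow> v \<in> verts ?G \<Longrightarrow> w \<in> verts ?G \<Longrightarrow> adj ?G v w" for v w
    by (auto simp: graph_join_def complete_graph_def split: sum.splits)
  have irrefl: "\<not> adj ?G' (Inl n) (Inl n)"
    by (simp add: graph_join_def complete_graph_def)
  have "proper_coloring ?G' (c(Inl n := x))"
    unfolding proper_coloring_def verts
  proof (intro ballI impI)
    fix v w assume "v \<in> insert (Inl n) (verts ?G)" "w \<in> insert (Inl n) (verts ?G)"
      and "adj ?G' v w"
    moreover have "Inl n \<notin> verts ?G"
      by (auto simp: graph_join_def complete_graph_def)
    ultimately show "(c(Inl n := x)) v \<noteq> (c(Inl n := x)) w"
      using c(1) cx adj irrefl unfolding proper_coloring_def by (metis fun_upd_apply insertE)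
  qed
  moreover have "\<forall>v\<in>verts ?G'. (c(Inl n := x)) v \<in> L v"
    using c(2) M x verts by auto
  ultimately show "\<exists>c. proper_coloring ?G' c \<and> (\<forall>v\<in>verts ?G'. c v \<in> L v)" by blast
qed

lemma choosable_join_complete_add:
  assumes "choosable (graph_join (complete_graph n) H) k"
  shows "choosable (graph_join (complete_graph (n + d)) H) (k + d)"
  by (induction d) (use assms choosable_join_complete_Suc in auto)

section \<open>Cones over complete bipartite graphs\<close>

abbreviation cone :: "nat \<Rightarrow> nat \<Rightarrow> nat \<Rightarrow> (nat + nat + nat) graph" where
  "cone n a b \<equiv> graph_join (complete_graph n) (complete_bipartite_graph a b)"

lemma verts_cone:
  "verts (cone n a b) = Inl ` {..<n} \<union> (Inr \<circ> Inl) ` {..<a} \<union> (Inr \<circ> Inr) ` {..<b}"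
  by (auto simp: graph_join_def complete_graph_def complete_bipartite_graph_def)

lemma finite_simple_cone: "finite_simple_graph (cone n a b)"
  by (intro finite_simple_graph_join finite_simple_complete_graph
      finite_simple_complete_bipartite_graph)

lemma card_verts_cone: "card (verts (cone n a b)) \<le> n + a + b"
proof -
  have "card (verts (cone n a b)) \<le> card (Inl ` {..<n} :: (nat + nat + nat) set)
      + card ((Inr \<circ> Inl) ` {..<a} :: (nat + nat + nat) set)
      + card ((Inr \<circ> Inr) ` {..<b} :: (nat + nat + nat) set)"
    unfolding verts_cone by (intro order_trans[OF card_Un_le] add_right_mono card_Un_le)
  also have "\<dots> \<le> n + a + b"
    by (intro add_mono order_trans[OF card_image_le]) auto
  finally show ?thesis .
qed

lemma proper_coloring_cone_iff:
  "proper_coloring (cone n a b) c \<longleftrightarrow>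
     inj_on (\<lambda>i. c (Inl i)) {..<n} \<and>
     (\<forall>i<n. \<forall>j<a. c (Inl i) \<noteq> c (Inr (Inl j))) \<and>
     (\<forall>i<n. \<forall>j<b. c (Inl i) \<noteq> c (Inr (Inr j))) \<and>
     (\<forall>i<a. \<forall>j<b. c (Inr (Inl i)) \<noteq> c (Inr (Inr j)))" (is "?L \<longleftrightarrow> ?R")
proof
  assume L: ?L
  have 1: "c (Inl i) \<noteq> c (Inl j)" if "i < n" "j < n" "i \<noteq> j" for i j
    using L[unfolded proper_coloring_def, rule_format, of "Inl i" "Inl j"] that
    by (auto simp: graph_join_def complete_graph_def complete_bipartite_graph_def)
  have 2: "c (Inl i) \<noteq> c (Inr (Inl j))" if "i < n" "j < a" for i j
    using L[unfolded proper_coloring_def, rule_format, of "Inl i" "Inr (Inl j)"] that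
    by (auto simp: graph_join_def complete_graph_def complete_bipartite_graph_def)
  have 3: "c (Inl i) \<noteq> c (Inr (Inr j))" if "i < n" "j < b" for i j
    using L[unfolded proper_coloring_def, rule_format, of "Inl i" "Inr (Inr j)"] that
    by (auto simp: graph_join_def complete_graph_def complete_bipartite_graph_def)
  have 4: "c (Inr (Inl i)) \<noteq> c (Inr (Inr j))" if "i < a" "j < b" for i j
    using L[unfolded proper_coloring_def, rule_format, of "Inr (Inl i)" "Inr (Inr j)"] that
    by (auto simp: graph_join_def complete_graph_def complete_bipartite_graph_def)
  show ?R using 1 2 3 4 by (auto simp: inj_on_def)
next
  assume R: ?R
  show ?L
    unfolding proper_coloring_def
    using R by (fastforce simp: graph_join_def complete_graph_def
        complete_bipartite_graph_def inj_on_def split: sum.splits)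
qed

text \<open>The clique and one vertex of each side are pairwise adjacent, which forces
  \<open>n + 2\<close> colours.\<close>

lemma chromatic_number_cone:
  assumes "a > 0" and "b > 0"
  shows "chromatic_number (cone n a b) = n + 2"
  unfolding chromatic_number_def
proof (rule Least_equality)
  let ?c = "\<lambda>v. case v of Inl i \<Rightarrow> i | Inr (Inl j) \<Rightarrow> n | Inr (Inr j) \<Rightarrow> Suc n"
  have "proper_coloring (cone n a b) ?c"
    unfolding proper_coloring_cone_iff by (auto simp: inj_on_def)
  moreover have "\<forall>v\<in>verts (cone n a b). ?c v < n + 2"
    by (auto simp: verts_cone)
  ultimately show "colorable (cone n a b) (n + 2)" unfolding colorable_def by blast
next
  fix k assume "colorable (cone n a b) k"
  then obtain c :: "nat + nat + nat \<Rightarrow> nat" where c: "proper_coloring (cone n a b) c"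
    "\<forall>v\<in>verts (cone n a b). c v < k" unfolding colorable_def by blast
  let ?S = "insert (c (Inr (Inl 0))) (insert (c (Inr (Inr 0))) ((\<lambda>i. c (Inl i)) ` {..<n}))"
  have "card ((\<lambda>i. c (Inl i)) ` {..<n}) = n"
    using c(1) unfolding proper_coloring_cone_iff by (simp add: card_image)
  moreover have "c (Inr (Inr 0)) \<notin> (\<lambda>i. c (Inl i)) ` {..<n}"
    "c (Inr (Inl 0)) \<notin> insert (c (Inr (Inr 0))) ((\<lambda>i. c (Inl i)) ` {..<n})"
    using c(1) assms unfolding proper_coloring_cone_iff by force+
  ultimately have "card ?S = n + 2" by simp
  moreover have "?S \<subseteq> {..<k}" using c(2) assms by (auto simp: verts_cone)
  ultimately show "n + 2 \<le> k" by (metis card_lessThan card_mono finite_lessThan)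
qed

section \<open>Choosability of cones with a large clique\<close>

text \<open>Spend only \<open>x\<close> on the first side. The clique gets distinct colours other
  than \<open>x\<close> by Hall's theorem, so \<open>n + 1\<close> colours are used in all and each
  list on the second side has one left.\<close>

lemma cone_coloring_of_common_color:
  fixes L :: "nat + nat + nat \<Rightarrow> nat set"
  assumes L: "\<forall>v\<in>verts (cone n a b). finite (L v) \<and> card (L v) = n + 2"
    and x: "\<forall>j<a. x \<in> L (Inr (Inl j))"
  shows "\<exists>c. proper_coloring (cone n a b) c \<and> (\<forall>v\<in>verts (cone n a b). c v \<in> L v)"
proof -
  let ?M = "\<lambda>i. L (Inl i) - {x}"
  have LK: "finite (L (Inl i))" "card (L (Inl i)) = n + 2" if "i < n" for i
    using L that by (auto simp: verts_cone)
  have "\<exists>f. inj_on f {..<n} \<and> (\<forall>i\<in>{..<n}. f i \<in> ?M i)"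
  proof (rule hall_marriage)
    fix S assume S: "S \<subseteq> {..<n}"
    show "card S \<le> card (\<Union>(?M ` S))"
    proof (cases "S = {}")
      case False
      then obtain i where i: "i \<in> S" by blast
      have "card S \<le> n" using S by (metis card_lessThan card_mono finite_lessThan)
      also have "n \<le> card (?M i)"
        using LK[of i] i S by (auto simp: card_Diff_singleton_if)
      also have "\<dots> \<le> card (\<Union>(?M ` S))"
        using i S LK finite_subset[OF S] by (intro card_mono) auto
      finally show ?thesis .
    qed simp
  qed (use LK in auto)
  then obtain f where f: "inj_on f {..<n}" "\<forall>i<n. f i \<in> L (Inl i) - {x}" by auto
  have "\<exists>y. y \<in> L (Inr (Inr j)) - insert x (f ` {..<n})" if "j < b" for j
  proof (rule ccontr)
    assume "\<not> ?thesis"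
    then have "L (Inr (Inr j)) \<subseteq> insert x (f ` {..<n})" by blast
    then have "card (L (Inr (Inr j))) \<le> card (insert x (f ` {..<n}))"
      by (intro card_mono) auto
    also have "\<dots> \<le> Suc n"
      using card_image_le[of "{..<n}" f] by (simp add: card_insert_if)
    finally show False using L that by (auto simp: verts_cone)
  qed
  then obtain g where g: "\<forall>j<b. g j \<in> L (Inr (Inr j)) - insert x (f ` {..<n})" by metis
  have fg: "f i \<noteq> g j" if "i < n" "j < b" for i j
    using g that by (metis DiffD2 image_eqI insertI2 lessThan_iff)
  let ?c = "\<lambda>v. case v of Inl i \<Rightarrow> f i | Inr (Inl j) \<Rightarrow> x | Inr (Inr j) \<Rightarrow> g j"
  have "proper_coloring (cone n a b) ?c"
    unfolding proper_coloring_cone_iff using f g fg by (auto simp: inj_on_def)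
  moreover have "\<forall>v\<in>verts (cone n a b). ?c v \<in> L v"
    using f g x by (auto simp: verts_cone)
  ultimately show ?thesis by blast
qed

text \<open>Without a common colour the complements \<open>P - L j\<close> cover \<open>P\<close>,
  but each has at most \<open>m\<close> elements and \<open>a * m < k\<close>.\<close>

lemma common_color_of_small_pot:
  fixes L :: "nat \<Rightarrow> nat set"
  assumes "finite P" and "card P \<le> k + m" and "a * m < k"
    and L: "\<And>j. j < a \<Longrightarrow> L j \<subseteq> P \<and> card (L j) = k"
    and "k \<le> card P"
  shows "\<exists>x. \<forall>j<a. x \<in> L j"
proof (rule ccontr)
  assume "\<not> ?thesis"
  then have "P \<subseteq> (\<Union>j<a. P - L j)" by blast
  then have "card P \<le> card (\<Union>j<a. P - L j)" using assms(1) by (intro card_mono) auto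
  also have "\<dots> \<le> (\<Sum>j<a. card (P - L j))" by (rule card_UN_le) simp
  also have "\<dots> \<le> (\<Sum>j<a. m)"
  proof (rule sum_mono)
    fix j assume "j \<in> {..<a}"
    then have "L j \<subseteq> P" "card (L j) = k" using L[of j] by auto
    then show "card (P - L j) \<le> m"
      using assms(1,2) finite_subset[of "L j" P] by (simp add: card_Diff_subset)
  qed
  finally show False using assms by simp
qed

text \<open>Kierstead's small pot reduction: if \<open>S\<close> is maximal with \<open>|L(S)| \<le> |S|\<close>, then the
  vertices outside \<open>S\<close> get distinct colours outside \<open>L(S)\<close> by Hall's theorem, and \<open>S\<close> only
  sees the \<open>|S|\<close> colours of \<open>L(S)\<close>, so that the lists on the first side overlap in a colour.
  Without this bound the \<open>LEAST\<close> in \<open>tau\<close> could range over an empty set.\<close>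

lemma choosable_large_cone:
  assumes n: "n \<ge> a * (a + b)"
  shows "choosable (cone n a b) (n + 2)"
  unfolding choosable_def
proof (intro allI impI)
  let ?G = "cone n a b" and ?V = "verts (cone n a b)"
  fix L :: "nat + nat + nat \<Rightarrow> nat set"
  assume L: "\<forall>v\<in>?V. finite (L v) \<and> card (L v) = n + 2"
  have finV: "finite ?V" by (simp add: verts_cone)
  have finL: "finite (\<Union>(L ` S))" if "S \<subseteq> ?V" for S
    using that L finite_subset[OF that finV] by auto
  let ?P = "\<lambda>S. S \<subseteq> ?V \<and> card (\<Union>(L ` S)) \<le> card S"
  have "\<exists>S. ?P S \<and> (\<forall>T. ?P T \<longrightarrow> card T \<le> card S)"
    using Lattices_Big.ex_has_greatest_nat[of ?P "{}" card "Suc (card ?V)"] card_mono[OF finV]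
    by (simp add: less_Suc_eq_le)
  then obtain S where S: "S \<subseteq> ?V" "card (\<Union>(L ` S)) \<le> card S"
    and max: "\<And>T. ?P T \<Longrightarrow> card T \<le> card S" by blast
  have finS: "finite S" using S finV finite_subset by blast
  let ?L = "\<lambda>v. L v - \<Union>(L ` S)"
  have "\<exists>f. inj_on f (?V - S) \<and> (\<forall>v\<in>?V - S. f v \<in> ?L v)"
  proof (rule hall_marriage)
    fix T assume T: "T \<subseteq> ?V - S"
    have finT: "finite T" using T finV finite_subset by blast
    show "card T \<le> card (\<Union>(?L ` T))"
    proof (rule ccontr)
      assume lt: "\<not> ?thesis"
      \<comment> \<open>A set \<open>T\<close> violating Hall's condition could be added to
        \<open>S\<close>, against maximality.\<close>
      have disj: "S \<inter> T = {}" using T by blast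
      have "\<Union>(L ` (S \<union> T)) = \<Union>(L ` S) \<union> \<Union>(?L ` T)" by auto
      then have "card (\<Union>(L ` (S \<union> T))) \<le> card (\<Union>(L ` S)) + card (\<Union>(?L ` T))"
        by (metis card_Un_le)
      also have "\<dots> \<le> card S + card T" using lt S(2) by linarith
      also have "\<dots> = card (S \<union> T)" using finS finT disj by (simp add: card_Un_disjoint)
      finally have "?P (S \<union> T)" using S T by blast
      then have "card (S \<union> T) \<le> card S" by (rule max)
      then have "card T = 0" using finS finT disj by (simp add: card_Un_disjoint)
      then show False using lt by simp
    qed
  qed (use L finV in auto)
  then obtain f where f: "inj_on f (?V - S)" "\<forall>v\<in>?V - S. f v \<in> ?L v" by blast
  have "\<exists>c. proper_coloring ?G c \<and> (\<forall>v\<in>S. c v \<in> L v)"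
  proof (cases "S = {}")
    case True
    then have "proper_coloring ?G f"
      using f(1) by (intro proper_coloring_of_inj finite_simple_cone) simp
    then show ?thesis using True by blast
  next
    case False
    then obtain w where w: "w \<in> S" by blast
    let ?P = "\<Union>(L ` S)"
    \<comment> \<open>Vertices outside \<open>S\<close> get a placeholder list inside the pot, so
      the whole cone can be coloured; their colours are later replaced by those of
      \<open>f\<close>.\<close>
    define M where "M v = (if v \<in> S then L v else L w)" for v
    have M: "finite (M v) \<and> card (M v) = n + 2 \<and> M v \<subseteq> ?P" if "v \<in> ?V" for v
      using that L w S(1) by (auto simp: M_def)
    have "card ?P \<le> card ?V" using S card_mono[OF finV S(1)] by linarith
    then have le: "card ?P \<le> n + 2 + (a + b)" using card_verts_cone[of n a b] by linarith
    have "card (L w) = n + 2" using L w S(1) by blast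
    then have ge: "n + 2 \<le> card ?P"
      using card_mono[OF finL[OF S(1)], of "L w"] w by auto
    have "\<exists>x. \<forall>j<a. x \<in> M (Inr (Inl j))"
    proof (rule common_color_of_small_pot[OF finL[OF S(1)] le _ _ ge])
      show "M (Inr (Inl j)) \<subseteq> ?P \<and> card (M (Inr (Inl j))) = n + 2" if "j < a" for j
        using M[of "Inr (Inl j)"] that by (auto simp: verts_cone)
    qed (use n in simp)
    then obtain x where "\<forall>j<a. x \<in> M (Inr (Inl j))" by blast
    moreover have "\<forall>v\<in>?V. finite (M v) \<and> card (M v) = n + 2" using M by blast
    ultimately have "\<exists>c. proper_coloring ?G c \<and> (\<forall>v\<in>?V. c v \<in> M v)"
      by (intro cone_coloring_of_common_color)
    then obtain c where c: "proper_coloring ?G c" "\<forall>v\<in>?V. c v \<in> M v" by blast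
    have "\<forall>v\<in>S. c v \<in> L v"
    proof
      fix v assume "v \<in> S"
      then show "c v \<in> L v" using c(2) S(1) by (auto simp: M_def dest: bspec[of _ _ v])
    qed
    then show ?thesis using c(1) by blast
  qed
  then obtain c where c: "proper_coloring ?G c" "\<forall>v\<in>S. c v \<in> L v" by blast
  define d where "d v = (if v \<in> S then c v else f v)" for v
  have "proper_coloring ?G d"
    unfolding proper_coloring_def
  proof (intro ballI impI)
    fix v w assume vw: "v \<in> ?V" "w \<in> ?V" "adj ?G v w"
    then have "v \<noteq> w" using finite_simple_cone finite_simple_graph_adj_neq by metis
    have outside: "f v' \<noteq> c w'" if "v' \<in> ?V - S" "w' \<in> S" for v' w'
      using f(2) c(2) that by (metis DiffD2 UN_I)
    show "d v \<noteq> d w"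
      using c(1) f(1) vw \<open>v \<noteq> w\<close> outside[of v w] outside[of w v]
      unfolding proper_coloring_def
      by (cases "v \<in> S"; cases "w \<in> S") (auto simp: d_def inj_on_def)
  qed
  moreover have "\<forall>v\<in>?V. d v \<in> L v" using c(2) f(2) by (auto simp: d_def)
  ultimately show "\<exists>c. proper_coloring ?G c \<and> (\<forall>v\<in>?V. c v \<in> L v)" by blast
qed

section \<open>Reduction of the bound on \<open>tau\<close> to a single cone\<close>

text \<open>If \<open>tau s a b = n < l\<close>, the cone with clique size \<open>n\<close> is
  \<open>(n + 2 + s)\<close>-choosable, and enlarging the clique by \<open>l - 1 - n\<close>
  vertices contradicts \<open>bad\<close>.\<close>

lemma tau_ge_of_not_choosable:
  assumes "a > 0" and "b > 0" and "l > 0"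
    and bad: "\<not> choosable (cone (l - 1) a b) (l + s + 1)"
  shows "l \<le> tau s a b"
proof (rule ccontr)
  let ?gap = "\<lambda>n. int (list_chromatic_number (cone n a b)) - int (chromatic_number (cone n a b))
    \<le> int s"
  define n where "n = tau s a b"
  assume "\<not> ?thesis"
  then have nl: "n < l" by (simp add: n_def)
  have "list_chromatic_number (cone (a * (a + b)) a b) \<le> a * (a + b) + 2"
    unfolding list_chromatic_number_def by (intro Least_le choosable_large_cone) simp
  moreover have "chromatic_number (cone (a * (a + b)) a b) = a * (a + b) + 2"
    using assms(1,2) by (rule chromatic_number_cone)
  ultimately have "?gap (a * (a + b))" by linarith
  then have "?gap n" unfolding n_def tau_def by (rule LeastI)
  then have "list_chromatic_number (cone n a b) \<le> n + 2 + s"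
    using assms(1,2) by (simp add: chromatic_number_cone)
  then have "choosable (cone n a b) (n + 2 + s)"
    using not_choosable_imp_less_list_chromatic_number[OF finite_simple_cone] by (meson not_less)
  then have "choosable (cone (n + (l - 1 - n)) a b) (n + 2 + s + (l - 1 - n))"
    by (rule choosable_join_complete_add)
  moreover have "n + (l - 1 - n) = l - 1" "n + 2 + s + (l - 1 - n) = l + s + 1"
    using nl by auto
  ultimately show False using bad by metis
qed

section \<open>The bad list assignment\<close>

lemma balanced_partition:
  fixes k N :: nat
  defines "q \<equiv> k div N"
  defines "u \<equiv> (N - k mod N) * q"
  assumes "N > 0"
  obtains p :: "nat \<Rightarrow> nat" where
    "\<And>c. c < k \<Longrightarrow> p c < N" and
    "\<And>i. card {c. c < k \<and> p c = i} \<le> q + 1" and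
    "\<And>c. c < u \<Longrightarrow> card {x. x < k \<and> p x = p c} \<le> q"
proof
  define m where "m = N - k mod N"
  \<comment> \<open>The first \<open>u = m * q\<close> colours form \<open>m\<close> intervals of
    length \<open>q\<close>, the others \<open>k mod N\<close> intervals of length
    \<open>q + 1\<close>. Placing the short parts first makes their union the initial segment
    \<open>{..<u}\<close>.\<close>
  define p where "p c = (if c < u then c div q else m + (c - u) div (q + 1))" for c
  have mN: "m \<le> N" "N - m = k mod N"
    using assms(3) by (simp_all add: m_def less_imp_le)
  have u: "u = m * q" by (simp add: u_def m_def)
  have "k = N * q + k mod N" by (simp add: q_def)
  also have "\<dots> = m * q + (N - m) * q + (N - m)"
    using mN by (metis add_mult_distrib le_add_diff_inverse)
  finally have k: "k = u + (N - m) * (q + 1)" by (simp add: u)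
  have small: "p c < m" if "c < u" for c
    using that by (simp add: p_def u less_mult_imp_div_less)
  show "p c < N" if "c < k" for c
  proof (cases "c < u")
    case True
    then show ?thesis using small mN by fastforce
  next
    case False
    then have "(c - u) div (q + 1) < N - m"
      using that k by (intro less_mult_imp_div_less) simp
    then show ?thesis using False by (simp add: p_def)
  qed
  have small_part: "card {c. c < k \<and> p c = i} \<le> q" if "i < m" for i
  proof -
    have "c \<in> {i * q..<i * q + q}" if "p c = i" for c
    proof -
      have c: "c < u" "c div q = i" using that \<open>i < m\<close> by (auto simp: p_def split: if_splits)
      then have "q > 0" by (cases "q = 0") (auto simp: u)
      then show ?thesis
        using c(2) dividend_less_div_times[of q c] by (auto simp: add.commute)
    qed
    then have sub: "{c. c < k \<and> p c = i} \<subseteq> {i * q..<i * q + q}" by blast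
    show ?thesis using card_mono[OF _ sub] by simp
  qed
  show "card {c. c < k \<and> p c = i} \<le> q + 1" for i
  proof (cases "i < m")
    case True
    then show ?thesis using small_part[of i] by simp
  next
    case False
    have "c \<in> {u + (i - m) * (q + 1)..<u + (i - m) * (q + 1) + (q + 1)}" if "p c = i" for c
    proof -
      have "\<not> c < u" using that False small[of c] by metis
      then have c: "u \<le> c" "i - m = (c - u) div (q + 1)"
        using that by (auto simp: p_def)
      then show ?thesis
        using dividend_less_div_times[of "q + 1" "c - u"]
          div_times_less_eq_dividend[of "c - u" "q + 1"]
        by (simp only: atLeastLessThan_iff) linarith
    qed
    then have sub: "{c. c < k \<and> p c = i} \<subseteq>
        {u + (i - m) * (q + 1)..<u + (i - m) * (q + 1) + (q + 1)}" by blast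
    show ?thesis using card_mono[OF _ sub] by simp
  qed
  show "card {x. x < k \<and> p x = p c} \<le> q" if "c < u" for c
    using small_part[OF small[OF that]] .
qed

text \<open>The possible sets of colours on the clique, the first-side vertex with list
  \<open>{..<k}\<close>, and one suitably chosen vertex among the last \<open>N\<close>. The removed
  pairs cannot occur: for \<open>T \<subseteq> {..<u}\<close> the part in question has at most
  \<open>q\<close> elements.\<close>

definition core_family :: "nat \<Rightarrow> nat \<Rightarrow> nat \<Rightarrow> nat \<Rightarrow> nat set set" where
  "core_family k l q u =
     {T. T \<subseteq> {..<k} \<and> card T = l + 1} \<union>
     (\<lambda>(T, x). insert x T) ` ({T. T \<subseteq> {..<k} \<and> card T = l} \<times> {k..<k + q + 1}
       - {T. T \<subseteq> {..<u} \<and> card T = l} \<times> {k + q})"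

lemma finite_core_family: "finite (core_family k l q u)"
  by (simp add: core_family_def)

lemma core_familyD:
  assumes "W \<in> core_family k l q u"
  shows "W \<subseteq> {..<k + q + 1} \<and> card W = l + 1"
  using assms unfolding core_family_def
proof (elim UnE)
  assume "W \<in> (\<lambda>(T, x). insert x T) ` ({T. T \<subseteq> {..<k} \<and> card T = l} \<times> {k..<k + q + 1}
       - {T. T \<subseteq> {..<u} \<and> card T = l} \<times> {k + q})"
  then obtain T x where T: "T \<subseteq> {..<k}" "card T = l" "x \<in> {k..<k + q + 1}" "W = insert x T"
    by blast
  then have "finite T" "x \<notin> T" using finite_subset by auto
  then show ?thesis using T by auto
qed auto

lemma card_core_family:
  assumes "u \<le> k"
  shows "card (core_family k l q u) \<le>
    (k choose (l + 1)) + ((k choose l) * (q + 1) - (u choose l))"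
proof -
  let ?X = "{T. T \<subseteq> {..<k} \<and> card T = l} \<times> {k..<k + q + 1}"
  let ?Y = "{T. T \<subseteq> {..<u} \<and> card T = l} \<times> {k + q}"
  have "card ?X = (k choose l) * (q + 1)" "card ?Y = u choose l"
    by (simp_all add: card_cartesian_product n_subsets)
  moreover have "?Y \<subseteq> ?X" using assms by auto
  ultimately have XY: "card (?X - ?Y) = (k choose l) * (q + 1) - (u choose l)"
    by (subst card_Diff_subset) (auto intro: finite_subset)
  have "card (core_family k l q u) \<le> card {T. T \<subseteq> {..<k} \<and> card T = l + 1}
      + card ((\<lambda>(T, x). insert x T) ` (?X - ?Y))"
    unfolding core_family_def by (rule card_Un_le)
  also have "\<dots> \<le> (k choose (l + 1)) + card (?X - ?Y)"
    using n_subsets[of "{..<k}" "l + 1"] by (intro add_mono card_image_le) auto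
  finally show ?thesis by (simp only: XY)
qed

text \<open>The bad list assignment. The clique and one vertex of the first side have the list
  \<open>C = {..<k}\<close> and so use an \<open>l\<close>-set \<open>T \<subseteq> C\<close>; another \<open>s\<close> vertices of the first side have
  pairwise disjoint fresh lists \<open>D j\<close>. The remaining \<open>N\<close> have lists \<open>(C - P i) \<union> {k..<k + |P i|}\<close>
  for a balanced partition \<open>P\<close> of \<open>C\<close>, so one of them must use a colour outside \<open>T\<close>. As
  \<open>{..<u}\<close> is the union of the parts of size \<open>q\<close>, the last extra colour \<open>k + q\<close> need not be
  blocked when \<open>T \<subseteq> {..<u}\<close>.\<close>

lemma not_choosable_cone:
  fixes k l s N b :: nat
  defines "q \<equiv> k div N"
  defines "u \<equiv> (N - k mod N) * q"
  assumes k: "k = l + s + 1" and "N > 0" and "l > 0"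
    and b: "k ^ s * ((k choose (l + 1)) + ((k choose l) * (q + 1) - (u choose l))) \<le> b"
  shows "\<not> choosable (cone (l - 1) (s + 1 + N) b) k"
proof
  assume choosable: "choosable (cone (l - 1) (s + 1 + N) b) k"
  let ?G = "cone (l - 1) (s + 1 + N) b"
  obtain p where p: "\<And>c. c < k \<Longrightarrow> p c < N" "\<And>i. card {c. c < k \<and> p c = i} \<le> q + 1"
      "\<And>c. c < u \<Longrightarrow> card {x. x < k \<and> p x = p c} \<le> q"
    using balanced_partition[of N k] assms(4) unfolding q_def u_def by blast
  define P where "P i = {c. c < k \<and> p c = i}" for i
  \<comment> \<open>The offset \<open>k + q + 1\<close> clears both \<open>{..<k}\<close> and the
    extra colours \<open>k\<close>, ..., \<open>k + q\<close>.\<close>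
  define D where "D j = {k + q + 1 + j * k..<k + q + 1 + j * k + k}" for j
  have D_disjoint: "j = j'" if x: "x \<in> D j" "x \<in> D j'" for j j' x
  proof -
    have "(x - (k + q + 1)) div k = i" if "x \<in> D i" for i
      using that by (intro div_nat_eqI) (auto simp: D_def algebra_simps)
    then show ?thesis using x by metis
  qed
  define F where "F = (\<lambda>(W, e). W \<union> e ` {..<s}) ` (core_family k l q u \<times> PiE {..<s} D)"
  have "u \<le> N * q" by (simp add: u_def)
  also have "\<dots> \<le> k" by (simp add: q_def)
  finally have "u \<le> k" .
  have finF: "finite F"
    unfolding F_def by (intro finite_imageI finite_cartesian_product finite_core_family finite_PiE)
      (auto simp: D_def)
  have "card F \<le> card (core_family k l q u \<times> PiE {..<s} D)"
    unfolding F_def by (intro card_image_le finite_cartesian_product finite_core_family finite_PiE)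
      (auto simp: D_def)
  also have "\<dots> = k ^ s * card (core_family k l q u)"
    by (simp add: card_cartesian_product card_PiE D_def)
  also have "\<dots> \<le> b"
    using card_core_family[OF \<open>u \<le> k\<close>] b by (meson le_trans mult_le_mono2)
  finally have "card F \<le> b" .
  obtain h where h: "bij_betw h {0..<card F} F" using ex_bij_betw_nat_finite[OF finF] by blast
  have cardF: "card X = k" if "X \<in> F" for X
  proof -
    obtain z where z: "z \<in> core_family k l q u \<times> PiE {..<s} D"
      "X = (\<lambda>(W, e). W \<union> e ` {..<s}) z"
      using \<open>X \<in> F\<close> unfolding F_def by (rule imageE)
    obtain W e where "z = (W, e)" by (cases z)
    then have We: "X = W \<union> e ` {..<s}" "W \<in> core_family k l q u" "e \<in> PiE {..<s} D"
      using z by simp_all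
    have e: "e j \<in> D j" if "j < s" for j using We(3) that by auto
    have "inj_on e {..<s}"
    proof (rule inj_onI)
      fix x y assume "x \<in> {..<s}" "y \<in> {..<s}" "e x = e y"
      then show "x = y" using e[of x] e[of y] D_disjoint by auto
    qed
    then have "card (e ` {..<s}) = s" by (simp add: card_image)
    moreover have W: "W \<subseteq> {..<k + q + 1}" "card W = l + 1" using core_familyD[OF We(2)] by auto
    moreover have "W \<inter> e ` {..<s} = {}" using W(1) e by (fastforce simp: D_def)
    ultimately show ?thesis
      using finite_subset[OF W(1)] by (simp add: We(1) card_Un_disjoint k)
  qed
  define A where "A j = (if j = 0 then {..<k} else if j \<le> s then D (j - 1)
    else ({..<k} - P (j - 1 - s)) \<union> {k..<k + card (P (j - 1 - s))})" for j
  \<comment> \<open>Second-side vertices beyond \<open>card F\<close> get an arbitrary list of the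
    right size.\<close>
  define B where "B j = (if j < card F then h j else {..<k})" for j
  define L where "L v = (case v of Inl i \<Rightarrow> {..<k} | Inr (Inl j) \<Rightarrow> A j | Inr (Inr j) \<Rightarrow> B j)"
    for v :: "nat + nat + nat"
  have "finite (A j) \<and> card (A j) = k" for j
  proof -
    have "card (({..<k} - P i) \<union> {k..<k + card (P i)}) = k" for i
    proof -
      have sub: "P i \<subseteq> {..<k}" by (auto simp: P_def)
      then have "card (P i) \<le> k" by (metis card_lessThan card_mono finite_lessThan)
      moreover have "card (({..<k} - P i) \<union> {k..<k + card (P i)})
          = card ({..<k} - P i) + card {k..<k + card (P i)}"
        by (intro card_Un_disjoint) auto
      ultimately show ?thesis
        using sub by (simp add: card_Diff_subset finite_subset)
    qed
    then show ?thesis by (simp add: A_def D_def)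
  qed
  moreover have "finite (B j) \<and> card (B j) = k" for j
  proof (cases "j < card F")
    case True
    then have "h j \<in> F" using h by (auto simp: bij_betw_def)
    then have "card (h j) = k" by (rule cardF)
    moreover from this have "finite (h j)" using k by (intro card_ge_0_finite) simp
    ultimately show ?thesis using True by (simp add: B_def)
  qed (simp add: B_def)
  ultimately have "finite (L v) \<and> card (L v) = k" for v
    by (auto simp: L_def split: sum.split)
  then obtain c where c: "proper_coloring ?G c" "\<And>v. v \<in> verts ?G \<Longrightarrow> c v \<in> L v"
    using choosableE[OF choosable, of L] by blast
  let ?x = "\<lambda>i. c (Inl i)" and ?y = "\<lambda>j. c (Inr (Inl j))" and ?z = "\<lambda>j. c (Inr (Inr j))"
  have xL: "?x i < k" if "i < l - 1" for i
    using c(2)[of "Inl i"] that by (auto simp: verts_cone L_def)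
  have yL: "?y j \<in> A j" if "j < s + 1 + N" for j
    using c(2)[of "Inr (Inl j)"] that by (auto simp: verts_cone L_def)
  have zL: "?z j \<in> B j" if "j < b" for j
    using c(2)[of "Inr (Inr j)"] that by (auto simp: verts_cone L_def)
  have inj: "inj_on ?x {..<l - 1}"
    and xy: "\<And>i j. i < l - 1 \<Longrightarrow> j < s + 1 + N \<Longrightarrow> ?x i \<noteq> ?y j"
    and xz: "\<And>i j. i < l - 1 \<Longrightarrow> j < b \<Longrightarrow> ?x i \<noteq> ?z j"
    and yz: "\<And>i j. i < s + 1 + N \<Longrightarrow> j < b \<Longrightarrow> ?y i \<noteq> ?z j"
    using c(1) unfolding proper_coloring_cone_iff by blast+
  define T where "T = insert (?y 0) (?x ` {..<l - 1})"
  have y0: "?y 0 < k" using yL[of 0] by (simp add: A_def)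
  have T: "T \<subseteq> {..<k}" using y0 xL by (auto simp: T_def)
  have "?y 0 \<notin> ?x ` {..<l - 1}" using xy by force
  then have cardT: "card T = l"
    using inj \<open>l > 0\<close> by (simp add: T_def card_image)
  have finT: "finite T" by (simp add: T_def)
  \<comment> \<open>The part containing the colour of vertex 0 selects the vertex to look at: its
    list omits \<open>P i\<close>, so its colour differs from \<open>?y 0\<close>, and adjacency
    keeps it off the clique's colours. Hence it lies outside \<open>T\<close>.\<close>
  define i where "i = p (?y 0)"
  have "i < N" using p(1)[OF y0] by (simp add: i_def)
  define y where "y = ?y (s + 1 + i)"
  have y: "y \<in> ({..<k} - P i) \<union> {k..<k + card (P i)}"
    using yL[of "s + 1 + i"] \<open>i < N\<close> by (simp add: A_def y_def)
  have y0P: "?y 0 \<in> P i" using y0 by (simp add: P_def i_def)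
  have "insert y T \<in> core_family k l q u"
  proof (cases "y < k")
    case True
    then have "y \<notin> P i" using y by auto
    then have "y \<noteq> ?y 0" using y0P by metis
    moreover have "?x i' \<noteq> y" if "i' < l - 1" for i'
      using xy[of i' "s + 1 + i"] that \<open>i < N\<close> by (simp add: y_def)
    then have "y \<notin> ?x ` {..<l - 1}" by auto
    ultimately have "y \<notin> T" by (simp add: T_def)
    then show ?thesis using True T finT cardT by (simp add: core_family_def)
  next
    case False
    then have yQ: "k \<le> y" "y < k + card (P i)" using y by auto
    have "y \<in> {k..<k + q + 1}" using yQ p(2)[of i] by (simp add: P_def)
    \<comment> \<open>Here \<open>?y 0 < u\<close>, so \<open>P i\<close> is a short part and the
      list of the chosen vertex stops before \<open>k + q\<close>.\<close>
    moreover have "y < k + q" if "T \<subseteq> {..<u}"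
      using that yQ(2) p(3)[of "?y 0"] by (simp add: T_def P_def i_def)
    ultimately have "(T, y) \<in> {T. T \<subseteq> {..<k} \<and> card T = l} \<times> {k..<k + q + 1}
       - {T. T \<subseteq> {..<u} \<and> card T = l} \<times> {k + q}"
      using T cardT by auto
    then have "(\<lambda>(T, x). insert x T) (T, y) \<in> core_family k l q u"
      unfolding core_family_def by (intro UnI2 imageI)
    then show ?thesis by simp
  qed
  moreover define e where "e = restrict (\<lambda>j. ?y (Suc j)) {..<s}"
  have "e \<in> PiE {..<s} D"
  proof -
    have "?y (Suc j) \<in> D j" if "j < s" for j
      using yL[of "Suc j"] that by (simp add: A_def)
    then show ?thesis by (simp add: e_def)
  qed
  ultimately have "(\<lambda>(W, e). W \<union> e ` {..<s}) (insert y T, e) \<in> F"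
    unfolding F_def by (intro imageI SigmaI)
  then have "insert y T \<union> e ` {..<s} \<in> h ` {0..<card F}"
    using h by (simp add: bij_betw_def)
  then obtain j where j: "j < card F" "h j = insert y T \<union> e ` {..<s}" by auto
  have jb: "j < b" using j(1) \<open>card F \<le> b\<close> by simp
  \<comment> \<open>The list of this second-side vertex consists of colours already used on its
    neighbours.\<close>
  have "?z j \<in> insert y T \<union> e ` {..<s}"
    using zL[OF jb] j by (simp add: B_def)
  then consider "?z j = ?y (s + 1 + i)" | "?z j = ?y 0" | i' where "i' < l - 1" "?z j = ?x i'"
    | j' where "j' < s" "?z j = ?y (Suc j')"
    by (auto simp: y_def T_def e_def)
  then show False
  proof cases
    case 1
    then show ?thesis using yz[of "s + 1 + i" j] jb \<open>i < N\<close> by simp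
  next
    case 2
    then show ?thesis using yz[of 0 j] jb by simp
  next
    case (3 i')
    then show ?thesis using xz[of i' j] jb by simp
  next
    case (4 j')
    then show ?thesis using yz[of "Suc j'" j] jb by simp
  qed
qed

section \<open>Translation of the integer hypotheses to natural numbers\<close>

theorem theorem9:
  fixes s l a b q u :: nat
  assumes "l \<ge> 2"
    and "a > s + 2"
    and "\<not> (a - s - 1) dvd (l + s + 1)"
    and "q = (l + s + 1) div (a - s - 1)"
    and "int u = ((1 + int q) * (int a - int s - 1) - (int l + int s + 1)) * int q"
    and "b \<ge> a"
    and "int b \<ge> (int l + int s + 1) ^ s *
           (int ((l + s + 1) choose (l + 1))
            + int ((l + s + 1) choose l) * (int q + 1)
            - int (u choose l))"
  shows "tau s a b \<ge> l"
proof -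
  define N where "N = a - s - 1"
  define k where "k = l + s + 1"
  have N: "N > 0" "a = s + 1 + N" using assms(2) by (auto simp: N_def)
  have q: "q = k div N" using assms(4) by (simp add: N_def k_def)
  have r: "k mod N \<le> N" using N(1) by (simp add: less_imp_le)
  have "int N * int q + int (k mod N) = int k"
    unfolding q by (metis mult_div_mod_eq of_nat_add of_nat_mult)
  then have "(1 + int q) * int N - int k = int (N - k mod N)"
    using r by (simp add: of_nat_diff algebra_simps)
  moreover have "int u = ((1 + int q) * int N - int k) * int q"
    using assms(5) by (simp add: N(2) k_def)
  ultimately have "int u = int ((N - k mod N) * q)" by simp
  then have u: "u = (N - k mod N) * q" by (simp only: of_nat_eq_iff)
  have "u \<le> N * q" by (simp add: u)
  also have "\<dots> \<le> k" by (simp add: q)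
  finally have "u choose l \<le> k choose l" by (rule binomial_right_mono)
  also have "\<dots> \<le> (k choose l) * (q + 1)" by simp
  \<comment> \<open>This makes truncated subtraction agree with the integer difference in the
    hypothesis on \<open>b\<close>.\<close>
  finally have le: "u choose l \<le> (k choose l) * (q + 1)" .
  have "int ((k choose l) * (q + 1) - (u choose l))
      = int (k choose l) * (int q + 1) - int (u choose l)"
    unfolding of_nat_diff[OF le] by (simp only: of_nat_mult of_nat_add of_nat_1)
  moreover have "int k ^ s * (int (k choose (l + 1)) + int (k choose l) * (int q + 1)
      - int (u choose l)) \<le> int b"
    using assms(7) unfolding k_def by (simp only: of_nat_add of_nat_1)
  ultimately have "int (k ^ s * ((k choose (l + 1)) + ((k choose l) * (q + 1) - (u choose l))))
      \<le> int b"
    by (simp only: of_nat_mult of_nat_add of_nat_power add_diff_eq)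
  then have "k ^ s * ((k choose (l + 1)) + ((k choose l) * (q + 1) - (u choose l))) \<le> b"
    by (simp only: of_nat_le_iff)
  then have "\<not> choosable (cone (l - 1) (s + 1 + N) b) k"
    using assms(1) N(1) by (intro not_choosable_cone) (simp_all add: k_def q u)
  then have "\<not> choosable (cone (l - 1) a b) (l + s + 1)"
    unfolding k_def N(2) .
  moreover have "a > 0" "b > 0" "l > 0" using assms(1,2,6) by linarith+
  ultimately show ?thesis by (intro tau_ge_of_not_choosable)
qed

end
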